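(* Let $K:X\to Y$ be a linear compact operator between Hilbert spaces with singular system $\{(\sigma_n,v_n,u_n)\}_{n\in\mathbb{N}}$. For $\alpha>0$ define the (nonlinear) operator $\mathcal{R}_\alpha:Y\to X$ by $$\mathcal{R}_\alpha y^\delta:=\sum_{n\in\mathbb{N}}\mathcal{H}_{\alpha,n}\big(\sigma_n^{1/3}\langle y^\delta,u_n\rangle\big)v_n,\qquad y^\delta\in Y.$$ Suppose that for every $\alpha>0$ there exists $c(\alpha)$ such that $c(\alpha)\sigma_n\ge\frac43$ for all $n$ for which $|\sigma_n^{1/3}\langle y^\delta,u_n\rangle|>\frac34\alpha^{2/3}$. Then $\mathcal{R}_\alpha$ is a regularization strategy with $\|\mathcal{R}_\alpha\|\le c(\alpha)$; that is: (i) $\|\mathcal{R}_\alpha y^\delta\|\le c(\alpha)\|y^\delta\|$ for $y^\delta\in Y$ (with $c(\alpha)$ satisfying, for this $y^\delta$, the condition that $c(\alpha)\sigma_n\ge\frac43$ for all $n$ for which $|\sigma_n^{1/3}\langle y^\delta,u_n\rangle|>\frac34\alpha^{2/3}$); (ii) $\lim_{\alpha\to0}\mathcal{R}_\alpha Kx=x$ for all $x\in X$.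
   Context: For $t\in\mathbb{R}$ and $\alpha>0$, the half thresholding function is $$\mathcal{H}_{\alpha,n}(t)=\begin{cases}\dfrac{2}{3\sigma_n^{4/3}}\,t\left(1+\cos\left(\frac{2}{3}\pi-\frac{2}{3}\phi_\alpha(t)\right)\right),& |t|>\frac34\alpha^{2/3},\\ 0,&|t|\le\frac34\alpha^{2/3},\end{cases}\qquad \phi_\alpha(t)=\arccos\left(\frac{\alpha}{8}\left(\frac{|t|}{3}\right)^{-3/2}\right).$$ A singular system $\{(\sigma_n,v_n,u_n)\}_{n\in\mathbb{N}}$ of $K$ consists of the singular values $\sigma_n>0$ in decreasing order (with multiplicity; $0<\sigma_n\le\|K\|$), i.e. the square roots of the eigenvalues of $K^*K$, and orthonormal systems $\{v_n\}\subset X$, $\{u_n\}\subset Y$ of eigenvectors of $K^*K$ and $KK^*$ with $Kv_n=\sigma_nu_n$ and $K^*u_n=\sigma_nv_n$. The paper's convention is that these systems are complete: every $x\in X$ and $y\in Y$ satisfies $x=\sum_n\langle x,v_n\rangle v_n$ and $y=\sum_n\langle y,u_n\rangle u_n$. The Hilbert spaces are real. A regularization strategy is a family of bounded operators $\mathcal{R}_\alpha:Y\to X$ such that $\lim_{\alpha\to0}\mathcal{R}_\alpha Kx=x$ for all $x\in X$; for these nonlinear operators the bound $\|\mathcal{R}_\alpha\|\le c(\alpha)$ means $\|\mathcal{R}_\alpha y^\delta\|\le c(\alpha)\|y^\delta\|$, where $c(\alpha)$ is allowed to depend on the data $y^\delta$ through the threshold condition.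
   Formalization: The constant c(α) is additionally required to be nonnegative; otherwise, when no index exceeds the threshold, the condition is void and a negative c(α) would make (i) false for nonzero data. *)

theory Defs
  imports "HOL-Analysis.Analysis"
begin

definition compact_operator :: "('a::real_normed_vector \<Rightarrow> 'b::real_normed_vector) \<Rightarrow> bool" where
  "compact_operator K \<longleftrightarrow> linear K \<and> (\<forall>S. bounded S \<longrightarrow> compact (closure (K ` S)))"

definition orthonormal_seq :: "(nat \<Rightarrow> 'a::real_inner) \<Rightarrow> bool" where
  "orthonormal_seq e \<longleftrightarrow> (\<forall>m n. e m \<bullet> e n = (if m = n then 1 else 0))"

definition complete_seq :: "(nat \<Rightarrow> 'a::real_inner) \<Rightarrow> bool" where
  "complete_seq e \<longleftrightarrow> (\<forall>x. (\<lambda>n. (x \<bullet> e n) *\<^sub>R e n) sums x)"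

text \<open>
  The library's \<^const>\<open>adjoint\<close> is the Hilbert-space adjoint here: for a bounded operator between
  complete spaces it exists and is unique. The two relations between \<open>v\<close> and \<open>u\<close> make
  \<open>v n\<close> and \<open>u n\<close> eigenvectors of \<open>K\<^sup>*K\<close> and \<open>KK\<^sup>*\<close> for the eigenvalue \<open>(\<sigma> n)\<^sup>2\<close>; by completeness
  of the systems, \<open>\<sigma>\<close> then lists every singular value with its multiplicity.
\<close>

definition singular_system ::
  "('a::{real_inner,complete_space} \<Rightarrow> 'b::{real_inner,complete_space}) \<Rightarrow>
     (nat \<Rightarrow> real) \<Rightarrow> (nat \<Rightarrow> 'a) \<Rightarrow> (nat \<Rightarrow> 'b) \<Rightarrow> bool" where
  "singular_system K \<sigma> v u \<longleftrightarrow>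
     (\<forall>n. 0 < \<sigma> n) \<and> decseq \<sigma> \<and>
     orthonormal_seq v \<and> orthonormal_seq u \<and>
     (\<forall>n. K (v n) = \<sigma> n *\<^sub>R u n) \<and> (\<forall>n. adjoint K (u n) = \<sigma> n *\<^sub>R v n) \<and>
     complete_seq v \<and> complete_seq u"

definition phi :: "real \<Rightarrow> real \<Rightarrow> real" where
  "phi \<alpha> t = arccos (\<alpha> / 8 * (\<bar>t\<bar> / 3) powr (- (3 / 2)))"

text \<open>The argument \<open>s\<close> stands for the singular value \<open>\<sigma> n\<close>, the only dependence on \<open>n\<close>.\<close>

definition half_threshold :: "real \<Rightarrow> real \<Rightarrow> real \<Rightarrow> real" where
  "half_threshold \<alpha> s t =
     (if \<bar>t\<bar> > 3 / 4 * \<alpha> powr (2 / 3)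
      then 2 / (3 * s powr (4 / 3)) * t * (1 + cos (2 / 3 * pi - 2 / 3 * phi \<alpha> t))
      else 0)"

definition reg_term ::
  "(nat \<Rightarrow> real) \<Rightarrow> (nat \<Rightarrow> 'a::real_inner) \<Rightarrow> (nat \<Rightarrow> 'b::real_inner) \<Rightarrow> real \<Rightarrow> 'b \<Rightarrow> nat \<Rightarrow> 'a" where
  "reg_term \<sigma> v u \<alpha> y n = half_threshold \<alpha> (\<sigma> n) (\<sigma> n powr (1 / 3) * (y \<bullet> u n)) *\<^sub>R v n"

definition reg_op ::
  "(nat \<Rightarrow> real) \<Rightarrow> (nat \<Rightarrow> 'a::real_inner) \<Rightarrow> (nat \<Rightarrow> 'b::real_inner) \<Rightarrow> real \<Rightarrow> 'b \<Rightarrow> 'a" where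
  "reg_op \<sigma> v u \<alpha> y = (\<Sum>n. reg_term \<sigma> v u \<alpha> y n)"

text \<open>
  Nonnegativity of the bound \<open>c\<close> matters only when no index exceeds the threshold:
  the remaining condition is then void and would admit negative \<open>c\<close>.
\<close>

definition threshold_bound ::
  "(nat \<Rightarrow> real) \<Rightarrow> (nat \<Rightarrow> 'b::real_inner) \<Rightarrow> real \<Rightarrow> 'b \<Rightarrow> real \<Rightarrow> bool" where
  "threshold_bound \<sigma> u \<alpha> y c \<longleftrightarrow>
     0 \<le> c \<and>
     (\<forall>n. \<bar>\<sigma> n powr (1 / 3) * (y \<bullet> u n)\<bar> > 3 / 4 * \<alpha> powr (2 / 3) \<longrightarrow> c * \<sigma> n \<ge> 4 / 3)"

end

theory Submission imports Defs begin

text \<open>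
  Write \<open>y\<^sub>n = y \<bullet> u n\<close>. On the scaled coefficient \<open>t = \<sigma>\<^sub>n powr (1/3) * y\<^sub>n\<close> the power of \<open>\<sigma>\<^sub>n\<close> in the
  half thresholding function combines to the plain inverse: with \<open>z = 2/3 \<pi> - 2/3 \<phi>(t)\<close>, the value
  \<open>H(t)\<close> is \<open>y\<^sub>n / \<sigma>\<^sub>n\<close> times \<open>2/3 (1 + cos z)\<close> above the threshold, and \<open>0\<close> below it. So the
  regularization is a spectral filter: the naive inverse \<open>y\<^sub>n / \<sigma>\<^sub>n\<close> is multiplied by a factor in
  \<open>[0, 4/3]\<close>, which may depend on the data. This single bound
  (\<open>half_threshold_bound\<close>) explains the constant \<open>4/3\<close> in the condition on \<open>c\<close>: together they give
  \<open>|H(t)| \<le> c |y\<^sub>n|\<close> for every \<open>n\<close>, and Parseval's identity in the two orthonormal systems turns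
  this into summability of the defining series and into \<open>\<parallel>R y\<parallel> \<le> c \<parallel>y\<parallel>\<close>
  (\<open>orthonormal_series_dominated\<close>).

  For exact data \<open>y = K x\<close> one has \<open>y\<^sub>n = \<sigma>\<^sub>n x\<^sub>n\<close> with \<open>x\<^sub>n = x \<bullet> v n\<close>, so the coefficients of
  the reconstruction are \<open>x\<^sub>n\<close> times the filter factor. As \<open>\<alpha>\<close> tends to \<open>0\<close> the threshold drops
  below any fixed nonzero coefficient, and \<open>\<phi>\<close> tends to \<open>arccos 0 = \<pi>/2\<close>, so the factor tends to
  \<open>2/3 (1 + cos (\<pi>/3)) = 1\<close> (\<open>half_threshold_tendsto\<close>). The squared error
  \<open>\<Sum>\<^sub>n (H\<^sub>n - x\<^sub>n)\<^sup>2\<close> is dominated termwise by a multiple of the summable \<open>x\<^sub>n\<^sup>2\<close>, uniformly in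
  \<open>\<alpha>\<close>; hence it tends to \<open>0\<close> by dominated convergence for series (Tannery's theorem).
\<close>

section \<open>Series in an orthonormal system\<close>

lemma orthonormal_norm_sum:
  assumes "orthonormal_seq e" "finite A"
  shows "(norm (\<Sum>i\<in>A. a i *\<^sub>R e i))\<^sup>2 = (\<Sum>i\<in>A. (a i)\<^sup>2)"
proof -
  have nrm: "norm (e i) = 1" for i
    using assms(1) by (simp add: orthonormal_seq_def norm_eq_sqrt_inner)
  have "pairwise (\<lambda>i j. orthogonal (a i *\<^sub>R e i) (a j *\<^sub>R e j)) A"
    using assms(1) by (auto simp: pairwise_def orthogonal_def orthonormal_seq_def)
  from norm_sum_Pythagorean[OF assms(2) this] show ?thesis
    by (simp add: nrm)
qed

lemma orthonormal_Parseval: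
  assumes "orthonormal_seq e" "(\<lambda>n. a n *\<^sub>R e n) sums x"
  shows "(\<lambda>n. (a n)\<^sup>2) sums (norm x)\<^sup>2"
proof -
  have "(\<lambda>n. (norm (\<Sum>i<n. a i *\<^sub>R e i))\<^sup>2) \<longlonglongrightarrow> (norm x)\<^sup>2"
    using assms(2) unfolding sums_def by (intro tendsto_intros)
  then show ?thesis
    using assms(1) by (simp add: sums_def orthonormal_norm_sum)
qed

text \<open>
  The Riesz--Fischer direction: by Pythagoras the partial sums of the vector series are as close
  together as the square roots of blocks of the scalar series, so they form a Cauchy sequence.
\<close>

lemma orthonormal_summable:
  fixes e :: "nat \<Rightarrow> 'a::{real_inner,complete_space}"
  assumes e: "orthonormal_seq e" and a: "summable (\<lambda>n. (a n)\<^sup>2)"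
  shows "summable (\<lambda>n. a n *\<^sub>R e n)"
proof -
  define S where "S n = (\<Sum>i<n. a i *\<^sub>R e i)" for n
  define T where "T n = (\<Sum>i<n. (a i)\<^sup>2)" for n
  have le: "(dist (S m) (S n))\<^sup>2 = dist (T m) (T n)" if "m \<le> n" for m n
  proof -
    have "S n - S m = (\<Sum>i\<in>{m..<n}. a i *\<^sub>R e i)" "T n - T m = (\<Sum>i\<in>{m..<n}. (a i)\<^sup>2)"
      using that by (simp_all add: S_def T_def sum_diff_nat_ivl lessThan_atLeast0)
    moreover have "0 \<le> (\<Sum>i\<in>{m..<n}. (a i)\<^sup>2)"
      by (intro sum_nonneg) auto
    ultimately show ?thesis
      using orthonormal_norm_sum[OF e, of "{m..<n}" a]
      by (simp add: dist_norm norm_minus_commute[of "S m"] abs_minus_commute[of "T m"])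
  qed
  have eq: "(dist (S m) (S n))\<^sup>2 = dist (T m) (T n)" for m n
    using le[of m n] le[of n m] by (cases "m \<le> n") (auto simp: dist_commute)
  have "Cauchy T"
    unfolding T_def by (intro convergent_Cauchy) (use a in \<open>simp add: summable_iff_convergent\<close>)
  have "Cauchy S"
  proof (rule metric_CauchyI)
    fix \<epsilon> :: real assume "0 < \<epsilon>"
    then obtain M where M: "\<forall>m\<ge>M. \<forall>n\<ge>M. dist (T m) (T n) < \<epsilon>\<^sup>2"
      using metric_CauchyD[OF \<open>Cauchy T\<close>, of "\<epsilon>\<^sup>2"] by auto
    have "dist (S m) (S n) < \<epsilon>" if "M \<le> m" "M \<le> n" for m n
    proof (rule power_less_imp_less_base)
      show "(dist (S m) (S n))\<^sup>2 < \<epsilon>\<^sup>2"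
        using M that by (simp only: eq)
    qed (use \<open>0 < \<epsilon>\<close> in simp)
    then show "\<exists>M. \<forall>m\<ge>M. \<forall>n\<ge>M. dist (S m) (S n) < \<epsilon>"
      by blast
  qed
  then show ?thesis
    by (simp only: summable_iff_convergent S_def[symmetric] Cauchy_convergent)
qed

text \<open>
  In the application the coefficient sequences belong to different systems: \<open>b\<close> holds the
  coefficients of the data in \<open>u\<close>, with norm \<open>r\<close>, and \<open>a\<close> those of the reconstruction in \<open>e = v\<close>.
\<close>

lemma orthonormal_series_dominated:
  fixes e :: "nat \<Rightarrow> 'a::{real_inner,complete_space}"
  assumes e: "orthonormal_seq e"
    and le: "\<And>n. \<bar>a n\<bar> \<le> c * \<bar>b n\<bar>" and b: "(\<lambda>n. (b n)\<^sup>2) sums r\<^sup>2"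
    and nonneg: "0 \<le> c" "0 \<le> r"
  shows "summable (\<lambda>n. a n *\<^sub>R e n)" and "norm (\<Sum>n. a n *\<^sub>R e n) \<le> c * r"
proof -
  have cb: "(\<lambda>n. c\<^sup>2 * (b n)\<^sup>2) sums (c * r)\<^sup>2"
    using sums_mult[OF b, of "c\<^sup>2"] by (simp add: power_mult_distrib)
  have sq: "(a n)\<^sup>2 \<le> c\<^sup>2 * (b n)\<^sup>2" for n
    using power_mono[OF le[of n] abs_ge_zero, of 2] by (simp add: power_mult_distrib)
  have "summable (\<lambda>n. (a n)\<^sup>2)"
    by (rule summable_comparison_test'[OF sums_summable[OF cb], of 0]) (use sq in auto)
  then show sm: "summable (\<lambda>n. a n *\<^sub>R e n)"
    by (rule orthonormal_summable[OF e])
  have "(norm (\<Sum>n. a n *\<^sub>R e n))\<^sup>2 \<le> (c * r)\<^sup>2"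
    using orthonormal_Parseval[OF e summable_sums[OF sm]] cb sq by (rule sums_le[rotated])
  then show "norm (\<Sum>n. a n *\<^sub>R e n) \<le> c * r"
    by (rule power2_le_imp_le) (use nonneg in simp)
qed

section \<open>The half thresholding function as a spectral filter\<close>

text \<open>
  The factor \<open>s powr (1 / 3)\<close> that scales the coefficient cancels against \<open>s powr (4 / 3)\<close> and leaves
  \<open>1 / s\<close>. In this form both the size of the value and its limit can be read off.
\<close>

lemma half_threshold_filter:
  assumes "0 < s"
  shows "half_threshold \<alpha> s (s powr (1 / 3) * r) =
     (if \<bar>s powr (1 / 3) * r\<bar> > 3 / 4 * \<alpha> powr (2 / 3)
      then r / s * (2 / 3 * (1 + cos (2 / 3 * pi - 2 / 3 * phi \<alpha> (s powr (1 / 3) * r))))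
      else 0)"
proof -
  have "s powr (4 / 3) = s powr (1 / 3) * s"
    using assms powr_add[of s "1 / 3" 1] by simp
  then have "2 / (3 * s powr (4 / 3)) * (s powr (1 / 3) * r) * z = r / s * (2 / 3 * z)" for z
    using assms by (simp add: field_simps)
  then show ?thesis
    by (simp only: half_threshold_def)
qed

lemma half_threshold_bound:
  assumes "0 < s"
  shows "\<bar>half_threshold \<alpha> s (s powr (1 / 3) * r)\<bar> \<le> 4 / 3 * \<bar>r / s\<bar>"
proof -
  have "\<bar>if b then r / s * (2 / 3 * (1 + cos z)) else 0\<bar> \<le> 4 / 3 * \<bar>r / s\<bar>" for b z
  proof -
    have "\<bar>1 + cos z\<bar> \<le> 2"
      using cos_ge_minus_one[of z] cos_le_one[of z] by linarith
    then have "\<bar>2 / 3 * (1 + cos z)\<bar> \<le> 4 / 3"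
      by (simp add: abs_mult)
    then have "\<bar>r / s\<bar> * \<bar>2 / 3 * (1 + cos z)\<bar> \<le> \<bar>r / s\<bar> * (4 / 3)"
      by (rule mult_left_mono) simp
    then show ?thesis
      by (simp only: abs_mult[of "r / s"] mult.commute[of "4 / 3"] split: if_split) simp
  qed
  then show ?thesis
    by (simp only: half_threshold_filter[OF assms])
qed

text \<open>
  For fixed \<open>t \<noteq> 0\<close> both the threshold and the argument of the arc cosine vanish with \<open>\<alpha>\<close>; the
  angle becomes \<open>2\<pi>/3 - \<pi>/3\<close>.
\<close>

lemma half_threshold_tendsto:
  assumes s: "0 < s"
  shows "((\<lambda>\<alpha>. half_threshold \<alpha> s (s powr (1 / 3) * r)) \<longlongrightarrow> r / s) (at_right 0)"
proof (cases "r = 0")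
  case True
  then show ?thesis
    by (simp add: half_threshold_def)
next
  case False
  define t where "t = s powr (1 / 3) * r"
  have t: "\<bar>t\<bar> > 0"
    using False s by (simp add: t_def)
  have id: "((\<lambda>\<alpha>::real. \<alpha>) \<longlongrightarrow> 0) (at_right 0)"
    by (rule tendsto_ident_at)
  have "((\<lambda>\<alpha>::real. 3 / 4 * \<alpha> powr (2 / 3)) \<longlongrightarrow> 3 / 4 * 0 powr (2 / 3)) (at_right 0)"
    by (intro tendsto_mult tendsto_const tendsto_powr'[OF id])
       (auto simp: eventually_at_filter)
  then have "\<forall>\<^sub>F \<alpha> in at_right 0. 3 / 4 * \<alpha> powr (2 / 3) < \<bar>t\<bar>"
    using t by (intro order_tendstoD) auto
  then have ev: "\<forall>\<^sub>F \<alpha> in at_right 0.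
      r / s * (2 / 3 * (1 + cos (2 / 3 * pi - 2 / 3 * phi \<alpha> t))) = half_threshold \<alpha> s t"
    by eventually_elim (simp only: t_def half_threshold_filter[OF s] if_True)
  have "((\<lambda>\<alpha>. \<alpha> / 8 * (\<bar>t\<bar> / 3) powr (- (3 / 2)))
      \<longlongrightarrow> 0 / 8 * (\<bar>t\<bar> / 3) powr (- (3 / 2))) (at_right 0)"
    by (intro tendsto_intros id) simp_all
  then have arg: "((\<lambda>\<alpha>. \<alpha> / 8 * (\<bar>t\<bar> / 3) powr (- (3 / 2))) \<longlongrightarrow> 0) (at_right 0)"
    by simp
  have "isCont arccos 0"
    by (rule isCont_arccos) simp_all
  from isCont_tendsto_compose[OF this arg]
  have "((\<lambda>\<alpha>. phi \<alpha> t) \<longlongrightarrow> pi / 2) (at_right 0)"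
    by (simp add: phi_def)
  then have "((\<lambda>\<alpha>. r / s * (2 / 3 * (1 + cos (2 / 3 * pi - 2 / 3 * phi \<alpha> t))))
      \<longlongrightarrow> r / s * (2 / 3 * (1 + cos (2 / 3 * pi - 2 / 3 * (pi / 2))))) (at_right 0)"
    by (intro tendsto_intros)
  moreover have "2 / 3 * pi - 2 / 3 * (pi / 2) = pi / 3"
    by simp
  ultimately have "((\<lambda>\<alpha>. r / s * (2 / 3 * (1 + cos (2 / 3 * pi - 2 / 3 * phi \<alpha> t))))
      \<longlongrightarrow> r / s) (at_right 0)"
    by (simp add: cos_60)
  from Lim_transform_eventually[OF this ev] show ?thesis
    by (simp only: t_def)
qed

section \<open>Coefficients of exact data\<close>

lemma compact_operator_bounded_linear:
  fixes K :: "'a::real_normed_vector \<Rightarrow> 'b::real_normed_vector"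
  assumes "compact_operator K"
  shows "bounded_linear K"
proof -
  have lin: "linear K" and "compact (closure (K ` cball 0 1))"
    using assms by (auto simp: compact_operator_def)
  then have "bounded (K ` cball 0 1)"
    using bounded_subset[OF compact_imp_bounded closure_subset] by blast
  then obtain B where B: "\<And>x. norm x \<le> 1 \<Longrightarrow> norm (K x) \<le> B"
    unfolding bounded_iff by (metis image_eqI mem_cball_0)
  have "norm (K x) \<le> norm x * B" for x
  proof (cases "x = 0")
    case True
    then show ?thesis using lin by (simp add: linear_0)
  next
    case False
    then have "norm (K (inverse (norm x) *\<^sub>R x)) \<le> B"
      by (intro B) simp
    then show ?thesis
      using False lin by (simp add: linear_scale field_simps)
  qed
  then show ?thesis
    using lin by (intro bounded_linear_intro[of K B]) (auto simp: linear_add linear_scale)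
qed

text \<open>
  The image of the expansion of \<open>x\<close> under the bounded operator \<open>K\<close> is an expansion of \<open>K x\<close> in
  \<open>u\<close>; taking the inner product with \<open>u m\<close> leaves one term.
\<close>

lemma singular_system_inner:
  fixes K :: "'a::{real_inner,complete_space} \<Rightarrow> 'b::{real_inner,complete_space}"
  assumes K: "bounded_linear K" and sys: "singular_system K \<sigma> v u"
  shows "K x \<bullet> u m = \<sigma> m * (x \<bullet> v m)"
proof -
  have Kv: "\<And>n. K (v n) = \<sigma> n *\<^sub>R u n" and u: "\<And>n. u n \<bullet> u m = (if n = m then 1 else 0)"
    and x: "(\<lambda>n. (x \<bullet> v n) *\<^sub>R v n) sums x"
    using sys by (auto simp: singular_system_def orthonormal_seq_def complete_seq_def)
  interpret K: bounded_linear K by (rule K)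
  have "(\<lambda>n. K ((x \<bullet> v n) *\<^sub>R v n) \<bullet> u m) sums (K x \<bullet> u m)"
    by (intro bounded_linear.sums[OF bounded_linear_inner_left] K.sums x)
  moreover have "K ((x \<bullet> v n) *\<^sub>R v n) \<bullet> u m = (if n = m then \<sigma> n * (x \<bullet> v n) else 0)" for n
    by (simp add: K.scaleR Kv u)
  ultimately show ?thesis
    using sums_single[of m "\<lambda>n. \<sigma> n * (x \<bullet> v n)"] sums_unique2 by simp
qed

section \<open>The regularization property\<close>

theorem theorem3p14:
  fixes K :: "'a::{real_inner,complete_space} \<Rightarrow> 'b::{real_inner,complete_space}"
    and \<sigma> :: "nat \<Rightarrow> real" and v :: "nat \<Rightarrow> 'a" and u :: "nat \<Rightarrow> 'b"
  assumes "compact_operator K"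
    and "singular_system K \<sigma> v u"
    and "\<forall>y. \<forall>\<alpha>>0. \<exists>c. threshold_bound \<sigma> u \<alpha> y c"
  shows "(\<forall>\<alpha>>0. \<forall>y. summable (reg_term \<sigma> v u \<alpha> y)) \<and>
         (\<forall>\<alpha>>0. \<forall>y c. threshold_bound \<sigma> u \<alpha> y c \<longrightarrow> norm (reg_op \<sigma> v u \<alpha> y) \<le> c * norm y) \<and>
         (\<forall>x. ((\<lambda>\<alpha>. reg_op \<sigma> v u \<alpha> (K x)) \<longlongrightarrow> x) (at_right 0))"
proof -
  have pos: "\<And>n. 0 < \<sigma> n" and v: "orthonormal_seq v" and u: "orthonormal_seq u"
    and cv: "\<And>x. (\<lambda>n. (x \<bullet> v n) *\<^sub>R v n) sums x" and cu: "\<And>y. (\<lambda>n. (y \<bullet> u n) *\<^sub>R u n) sums y"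
    using assms(2) by (auto simp: singular_system_def complete_seq_def)
  define h where "h \<alpha> y n = half_threshold \<alpha> (\<sigma> n) (\<sigma> n powr (1 / 3) * (y \<bullet> u n))" for \<alpha> y n
  have reg_term_eq: "reg_term \<sigma> v u \<alpha> y = (\<lambda>n. h \<alpha> y n *\<^sub>R v n)" for \<alpha> y
    by (simp add: fun_eq_iff reg_term_def h_def)
  have le: "\<bar>h \<alpha> y n\<bar> \<le> c * \<bar>y \<bullet> u n\<bar>" if c: "threshold_bound \<sigma> u \<alpha> y c" for \<alpha> y c n
  proof (cases "\<bar>\<sigma> n powr (1 / 3) * (y \<bullet> u n)\<bar> > 3 / 4 * \<alpha> powr (2 / 3)")
    case True
    with c have "4 / 3 \<le> c * \<sigma> n"
      by (auto simp: threshold_bound_def)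
    then have "4 / 3 / \<sigma> n \<le> c"
      using pos[of n] by (simp add: field_simps)
    then have "4 / 3 / \<sigma> n * \<bar>y \<bullet> u n\<bar> \<le> c * \<bar>y \<bullet> u n\<bar>"
      by (rule mult_right_mono) simp
    moreover have "\<bar>h \<alpha> y n\<bar> \<le> 4 / 3 / \<sigma> n * \<bar>y \<bullet> u n\<bar>"
      using half_threshold_bound[OF pos, of \<alpha> n "y \<bullet> u n"] pos[of n] by (simp add: h_def)
    ultimately show ?thesis by linarith
  next
    case False
    then show ?thesis
      using c by (simp add: h_def half_threshold_def threshold_bound_def)
  qed
  have sm: "summable (\<lambda>n. h \<alpha> y n *\<^sub>R v n)" and bd: "norm (\<Sum>n. h \<alpha> y n *\<^sub>R v n) \<le> c * norm y"
    if c: "threshold_bound \<sigma> u \<alpha> y c" for \<alpha> y c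
    using orthonormal_series_dominated[OF v le[OF c] orthonormal_Parseval[OF u cu]] c
    by (auto simp: threshold_bound_def)
  have sm_pos: "summable (\<lambda>n. h \<alpha> y n *\<^sub>R v n)" if "0 < \<alpha>" for \<alpha> y
    using assms(3) that sm by blast
  have conv: "((\<lambda>\<alpha>. reg_op \<sigma> v u \<alpha> (K x)) \<longlongrightarrow> x) (at_right 0)" for x
  proof -
    define d where "d \<alpha> n = h \<alpha> (K x) n - x \<bullet> v n" for \<alpha> n
    have Kx: "(K x \<bullet> u n) / \<sigma> n = x \<bullet> v n" for n
      using singular_system_inner[OF compact_operator_bounded_linear[OF assms(1)] assms(2)] pos[of n]
      by simp
    have "((\<lambda>\<alpha>. h \<alpha> (K x) n) \<longlongrightarrow> x \<bullet> v n) (at_right 0)" for n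
      using half_threshold_tendsto[OF pos, of n "K x \<bullet> u n"] by (simp add: Kx h_def)
    then have "((\<lambda>\<alpha>. (d \<alpha> n)\<^sup>2) \<longlongrightarrow> (x \<bullet> v n - x \<bullet> v n)\<^sup>2) (at_right 0)" for n
      unfolding d_def by (intro tendsto_intros)
    then have lim: "((\<lambda>\<alpha>. (d \<alpha> n)\<^sup>2) \<longlongrightarrow> 0) (at_right 0)" for n
      by simp
    \<comment> \<open>\<open>7/3\<close> is \<open>4/3\<close> from the filter bound plus \<open>1\<close> from subtracting the exact coefficient.\<close>
    have dle: "\<bar>d \<alpha> n\<bar> \<le> 7 / 3 * \<bar>x \<bullet> v n\<bar>" for \<alpha> n
      using half_threshold_bound[OF pos, of \<alpha> n "K x \<bullet> u n"]
      unfolding Kx d_def h_def by linarith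
    have dom: "norm ((d \<alpha> n)\<^sup>2) \<le> (7 / 3)\<^sup>2 * (x \<bullet> v n)\<^sup>2" for \<alpha> n
      using power_mono[OF dle[of \<alpha> n] abs_ge_zero, of 2] by (simp only: power_mult_distrib) simp
    have sum_dom: "summable (\<lambda>n. (7 / 3)\<^sup>2 * (x \<bullet> v n)\<^sup>2)"
      by (intro summable_mult sums_summable[OF orthonormal_Parseval[OF v cv]])
    have "\<forall>\<^sub>F (n, \<alpha>) in sequentially \<times>\<^sub>F at_right 0.
        norm ((d \<alpha> n)\<^sup>2) \<le> (7 / 3)\<^sup>2 * (x \<bullet> v n)\<^sup>2"
      by (rule always_eventually) (use dom in auto)
    from tannerys_theorem[where a = "\<lambda>n \<alpha>. (d \<alpha> n)\<^sup>2", OF lim this sum_dom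
        trivial_limit_at_right_real]
    have "((\<lambda>\<alpha>. \<Sum>n. (d \<alpha> n)\<^sup>2) \<longlongrightarrow> (\<Sum>n. 0)) (at_right 0)"
      by blast
    then have "((\<lambda>\<alpha>. \<Sum>n. (d \<alpha> n)\<^sup>2) \<longlongrightarrow> 0) (at_right 0)"
      by simp
    moreover have "\<forall>\<^sub>F \<alpha> in at_right 0. (\<Sum>n. (d \<alpha> n)\<^sup>2) = (norm (reg_op \<sigma> v u \<alpha> (K x) - x))\<^sup>2"
    proof -
      have "(\<Sum>n. (d \<alpha> n)\<^sup>2) = (norm (reg_op \<sigma> v u \<alpha> (K x) - x))\<^sup>2" if "0 < \<alpha>" for \<alpha>
      proof -
        have "(\<lambda>n. h \<alpha> (K x) n *\<^sub>R v n) sums reg_op \<sigma> v u \<alpha> (K x)"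
          using sm_pos[OF that] by (simp add: reg_op_def reg_term_eq summable_sums)
        from sums_diff[OF this cv[of x]]
        have "(\<lambda>n. d \<alpha> n *\<^sub>R v n) sums (reg_op \<sigma> v u \<alpha> (K x) - x)"
          by (simp add: d_def scaleR_diff_left)
        from orthonormal_Parseval[OF v this] show ?thesis
          by (rule sums_unique[symmetric])
      qed
      then show ?thesis
        by (auto simp: eventually_at_filter)
    qed
    ultimately have "((\<lambda>\<alpha>. (norm (reg_op \<sigma> v u \<alpha> (K x) - x))\<^sup>2) \<longlongrightarrow> 0) (at_right 0)"
      by (simp add: Lim_transform_eventually)
    from tendsto_real_sqrt[OF this]
    have "((\<lambda>\<alpha>. norm (reg_op \<sigma> v u \<alpha> (K x) - x)) \<longlongrightarrow> 0) (at_right 0)"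
      by simp
    then show ?thesis
      by (simp add: tendsto_norm_zero_iff LIM_zero_iff)
  qed
  show ?thesis
    using sm_pos bd conv unfolding reg_op_def reg_term_eq by blast
qed

end
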